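(* Let $S \subseteq \mathbb{N}_0$ be nonempty and let $\bar{c}_0, \bar{c}_1 \in (0,1)$. For every real number $H > 0$, $\bar{Q}(H) = 0$ if and only if $$\sum_{s \in S} \bar{c}_0^{sH} \bar{c}_1^{H} = 1,$$ where $\bar{Q}(t) = \limsup_{n\to\infty} \frac1n \log\left(\sum_{\omega \in \mathcal{G}_n} \bar{c}_\omega^t\right)$.
   Context: $\mathbb{N}_0 = \{0,1,2,\dots\}$. $\bar{c}_0, \bar{c}_1$ are the upper contraction constants of a hyperbolic iterated function system $\{\mathcal{K}; f_0,f_1\}$ (only the constants matter here). For a finite word $\omega = \omega_1\cdots\omega_n$ over $\{0,1\}$, $\bar{c}_\omega = \bar{c}_{\omega_1}\cdots \bar{c}_{\omega_n}$. For $n \ge 1$, $\mathcal{G}_n$ is the set of words of length $n$ of the form $0^{s_1}1 0^{s_2} 1 \cdots 0^{s_k} 1$ with $k \ge 1$ and $s_i \in S$ for $1 \le i \le k$. Convention: $\log 0 = -\infty$ (when $\mathcal{G}_n = \emptyset$). *)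

theory Defs
  imports "HOL-Analysis.Analysis"
begin

text \<open>Words over the alphabet \<open>{0, 1}\<close> are lists of natural numbers; a block \<open>0\<^sup>s 1\<close> is the
  list \<open>replicate s 0 @ [1]\<close>.\<close>

definition block_words :: "nat set \<Rightarrow> nat \<Rightarrow> nat list set" where
  "block_words S n = {w. length w = n \<and>
     (\<exists>ss. ss \<noteq> [] \<and> set ss \<subseteq> S \<and> w = concat (map (\<lambda>s. replicate s 0 @ [1]) ss))}"

definition word_ratio :: "(nat \<Rightarrow> real) \<Rightarrow> nat list \<Rightarrow> real" where
  "word_ratio c w = prod_list (map c w)"

text \<open>The library's \<open>ln\<close> on the reals has \<open>ln 0 = 0\<close>; here \<open>log 0 = -\<infinity>\<close> is needed.
  The function is only applied to non-negative arguments.\<close>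

definition log_ext :: "real \<Rightarrow> ereal" where
  "log_ext x = (if x = 0 then -\<infinity> else ereal (ln x))"

definition Qbar :: "nat set \<Rightarrow> (nat \<Rightarrow> real) \<Rightarrow> real \<Rightarrow> ereal" where
  "Qbar S c t =
     limsup (\<lambda>n. ereal (1 / real n) * log_ext (\<Sum>w\<in>block_words S n. word_ratio c w powr t))"

text \<open>The sums in \<open>Qbar\<close> are over finite sets.\<close>

lemma finite_block_words: "finite (block_words S n)"
proof (rule finite_subset)
  show "block_words S n \<subseteq> {w. set w \<subseteq> {0, 1} \<and> length w = n}"
    by (auto simp: block_words_def split: if_splits)
  show "finite {w. set w \<subseteq> {0, 1 :: nat} \<and> length w = n}"
    by (rule finite_lists_length_eq) simp
qed

end

theory Submission
  imports Defs
begin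

text \<open>Splitting off the first block \<open>0\<^sup>s 1\<close> of a word turns the sums
  \<open>u\<^sub>n = \<Sum>\<^bsub>\<omega> \<in> G\<^sub>n\<^esub> c\<^sub>\<omega>\<^sup>H\<close> into a renewal sequence: with \<open>u\<^sub>0 = 1\<close> and
  \<open>a\<^sub>s = c\<^sub>0\<^bsup>sH\<^esup> c\<^sub>1\<^sup>H\<close> for \<open>s \<in> S\<close>, \<open>a\<^sub>s = 0\<close> otherwise, one has
  \<open>u\<^bsub>n+1\<^esub> = \<Sum>\<^bsub>s \<le> n\<^esub> a\<^sub>s u\<^bsub>n-s\<^esub>\<close> (lemma \<open>block_sum_Suc\<close>). For the generating functions this is
  the identity \<open>U(x) = 1 + P(x) U(x)\<close> with \<open>P(x) = x \<Sum>\<^sub>s a\<^sub>s x\<^sup>s\<close>, so the exponential growth rate of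
  \<open>u\<close> is governed by where \<open>P\<close> crosses the level 1.

  If \<open>P(x) \<le> 1\<close>, then \<open>u\<^sub>n x\<^sup>n \<le> 1\<close> by induction, and the growth rate is at most \<open>- ln x\<close>
  (\<open>renewal_growth_le\<close>). If \<open>P(x) \<ge> 1\<close>, then \<open>U(x)\<close> cannot be finite, since that would give
  \<open>U(x) = 1 + P(x) U(x) \<ge> 1 + U(x)\<close>, and the growth rate is at least \<open>- ln x\<close>
  (\<open>renewal_growth_ge\<close>). The quantity in question is \<open>P(1)\<close>. If it equals 1, both bounds apply at
  \<open>x = 1\<close> and the rate is 0. Otherwise, \<open>c\<^sub>0 < 1\<close> makes the radius of convergence of \<open>P\<close> exceed 1,
  so by continuity \<open>P(x) \<le> 1\<close> still holds for some \<open>x > 1\<close>, or \<open>P(x) \<ge> 1\<close> for some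
  \<open>x < 1\<close>, and the rate is strictly negative or strictly positive.\<close>

section \<open>Exponential growth of renewal sequences\<close>

lemma renewal_nonneg:
  fixes a u :: "nat \<Rightarrow> real"
  assumes u0: "u 0 = 1" and rec: "\<And>n. u (Suc n) = (\<Sum>i\<le>n. a i * u (n - i))"
    and a: "\<And>i. 0 \<le> a i"
  shows "0 \<le> u n"
proof (induction n rule: less_induct)
  case (less n)
  then show ?case
    by (cases n) (auto simp: u0 rec intro!: sum_nonneg mult_nonneg_nonneg a)
qed

text \<open>Multiplying the recursion by \<open>x\<^bsup>n+1\<^esup>\<close> displays \<open>u\<^bsub>n+1\<^esub> x\<^bsup>n+1\<^esup>\<close> as a combination of the earlier
  \<open>u\<^sub>k x\<^sup>k\<close> whose weights add up to at most 1, so the bound 1 propagates.\<close>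

lemma renewal_le_1:
  fixes a u :: "nat \<Rightarrow> real"
  assumes u0: "u 0 = 1" and rec: "\<And>n. u (Suc n) = (\<Sum>i\<le>n. a i * u (n - i))"
    and a: "\<And>i. 0 \<le> a i" and x: "0 < x"
    and smm: "summable (\<lambda>i. a i * x ^ i)" and le: "x * (\<Sum>i. a i * x ^ i) \<le> 1"
  shows "u n * x ^ n \<le> 1"
proof (induction n rule: less_induct)
  case (less n)
  show ?case
  proof (cases n)
    case (Suc m)
    have "u n * x ^ n = x * (\<Sum>i\<le>m. (a i * x ^ i) * (u (m - i) * x ^ (m - i)))"
      unfolding Suc rec power_Suc sum_distrib_right sum_distrib_left
      by (intro sum.cong refl) (simp add: mult_ac flip: power_add)
    also have "\<dots> \<le> x * (\<Sum>i\<le>m. (a i * x ^ i) * 1)"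
      using less Suc a x
      by (intro mult_left_mono sum_mono) auto
    also have "\<dots> \<le> x * (\<Sum>i. a i * x ^ i)"
      using a x smm by (intro mult_left_mono) (auto intro!: sum_le_suminf)
    also have "\<dots> \<le> 1" by fact
    finally show ?thesis .
  qed (simp add: u0)
qed

lemma renewal_growth_le:
  fixes a u :: "nat \<Rightarrow> real"
  assumes u0: "u 0 = 1" and rec: "\<And>n. u (Suc n) = (\<Sum>i\<le>n. a i * u (n - i))"
    and a: "\<And>i. 0 \<le> a i" and x: "0 < x"
    and smm: "summable (\<lambda>i. a i * x ^ i)" and le: "x * (\<Sum>i. a i * x ^ i) \<le> 1"
  shows "limsup (\<lambda>n. ereal (1 / real n) * log_ext (u n)) \<le> ereal (- ln x)"
proof (rule Limsup_bounded, rule eventually_mono[OF eventually_gt_at_top[of 0]])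
  fix n :: nat assume n: "0 < n"
  show "ereal (1 / real n) * log_ext (u n) \<le> ereal (- ln x)"
  proof (cases "u n = 0")
    case True
    then show ?thesis using n by (simp add: log_ext_def)
  next
    case False
    then have pos: "0 < u n" using renewal_nonneg[of u a n, OF u0 rec a] by simp
    have "ln (u n * x ^ n) \<le> ln 1"
      using renewal_le_1[of u a x n, OF u0 rec a x smm le] pos x by (subst ln_le_cancel_iff) auto
    then have "ln (u n) + real n * ln x \<le> 0"
      using pos x by (simp add: ln_mult ln_realpow)
    then show ?thesis using False n by (simp add: log_ext_def field_simps)
  qed
qed

text \<open>If the growth rate were below \<open>- ln x\<close>, the series \<open>U(x) = \<Sum>\<^sub>n u\<^sub>n x\<^sup>n\<close> would converge by
  comparison with a geometric series, and the Cauchy product would give \<open>U(x) = 1 + P(x) U(x) > U(x)\<close>.\<close>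

lemma renewal_growth_ge:
  fixes a u :: "nat \<Rightarrow> real"
  assumes u0: "u 0 = 1" and rec: "\<And>n. u (Suc n) = (\<Sum>i\<le>n. a i * u (n - i))"
    and a: "\<And>i. 0 \<le> a i" and x: "0 < x"
    and smm: "summable (\<lambda>i. a i * x ^ i)" and ge: "1 \<le> x * (\<Sum>i. a i * x ^ i)"
  shows "ereal (- ln x) \<le> limsup (\<lambda>n. ereal (1 / real n) * log_ext (u n))"
proof (rule ccontr)
  assume "\<not> ?thesis"
  then have "limsup (\<lambda>n. ereal (1 / real n) * log_ext (u n)) < ereal (- ln x)" by simp
  then obtain z where z1: "limsup (\<lambda>n. ereal (1 / real n) * log_ext (u n)) < ereal z"
    and z2: "z < - ln x"
    using ereal_dense2[of _ "ereal (- ln x)"] by auto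
  have u: "0 \<le> u n" for n using renewal_nonneg[of u a n, OF u0 rec a] .
  define q where "q = exp z * x"
  have "exp z < exp (- ln x)" using z2 by (simp only: exp_less_cancel_iff)
  then have q: "0 < q" "q < 1" using x by (auto simp: q_def exp_minus field_simps)
  have ev: "eventually (\<lambda>n. ereal (1 / real n) * log_ext (u n) < ereal z) sequentially"
    using Limsup_lessD[OF z1] .
  have "eventually (\<lambda>n. norm (u n * x ^ n) \<le> q ^ n) sequentially"
    using ev eventually_gt_at_top[of 0]
  proof eventually_elim
    case (elim n)
    show ?case
    proof (cases "u n = 0")
      case False
      then have pos: "0 < u n" using u[of n] by simp
      have "ln (u n) \<le> real n * z" using elim False by (simp add: log_ext_def field_simps)
      then have "u n \<le> exp (real n * z)" using pos by (metis exp_le_cancel_iff exp_ln)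
      then have "u n * x ^ n \<le> exp z ^ n * x ^ n"
        using x by (simp add: exp_of_nat_mult)
      then show ?thesis using pos x by (simp add: q_def power_mult_distrib)
    qed (use q in auto)
  qed
  then have smu: "summable (\<lambda>n. u n * x ^ n)"
    using q by (intro summable_comparison_test_ev[OF _ summable_geometric]) auto
  define A where "A = (\<Sum>i. a i * x ^ i)"
  define U where "U = (\<Sum>n. u n * x ^ n)"
  have "(\<lambda>k. \<Sum>i\<le>k. (a i * x ^ i) * (u (k - i) * x ^ (k - i))) sums (A * U)"
    unfolding A_def U_def using smm smu a u x by (intro Cauchy_product_sums) auto
  then have "(\<lambda>k. x * (\<Sum>i\<le>k. (a i * x ^ i) * (u (k - i) * x ^ (k - i)))) sums (x * (A * U))"
    by (rule sums_mult)
  moreover have "x * (\<Sum>i\<le>k. (a i * x ^ i) * (u (k - i) * x ^ (k - i))) = u (Suc k) * x ^ Suc k"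
    for k
    unfolding rec power_Suc sum_distrib_right sum_distrib_left
    by (intro sum.cong refl) (simp add: mult_ac flip: power_add)
  ultimately have "(\<lambda>k. u (Suc k) * x ^ Suc k) sums (x * (A * U))" by simp
  then have "(\<lambda>k. u k * x ^ k) sums (x * (A * U) + u 0 * x ^ 0)"
    by (subst (asm) sums_Suc_iff) simp
  then have eq: "U = (x * A) * U + 1" by (simp add: U_def sums_iff u0 mult_ac)
  have "0 \<le> U" unfolding U_def using smu u x by (intro suminf_nonneg) auto
  then have "1 * U \<le> (x * A) * U" using ge unfolding A_def by (rule mult_right_mono[rotated])
  with eq show False by simp
qed

text \<open>A radius of convergence larger than 1 is what makes the rate strictly negative, and not merely
  nonpositive, when the total mass is below 1.\<close>

lemma renewal_growth_eq_0_iff: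
  fixes a u :: "nat \<Rightarrow> real"
  assumes u0: "u 0 = 1" and rec: "\<And>n. u (Suc n) = (\<Sum>i\<le>n. a i * u (n - i))"
    and a: "\<And>i. 0 \<le> a i"
    and r: "1 < r" and smm: "summable (\<lambda>i. a i * r ^ i)"
  shows "limsup (\<lambda>n. ereal (1 / real n) * log_ext (u n)) = 0 \<longleftrightarrow> (\<Sum>i. a i) = 1"
proof -
  let ?L = "limsup (\<lambda>n. ereal (1 / real n) * log_ext (u n))"
  define P where "P = (\<lambda>x. x * (\<Sum>i. a i * x ^ i))"
  have sm: "summable (\<lambda>i. a i * x ^ i)" if "0 < x" "x < r" for x
    using powser_inside[OF smm, of x] that by auto
  have le: "?L \<le> ereal (- ln x)" if "0 < x" "x < r" "P x \<le> 1" for x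
    using renewal_growth_le[of u a x, OF u0 rec a] sm that by (simp add: P_def)
  have ge: "ereal (- ln x) \<le> ?L" if "0 < x" "x < r" "1 \<le> P x" for x
    using renewal_growth_ge[of u a x, OF u0 rec a] sm that by (simp add: P_def)
  have "isCont P 1"
    unfolding P_def using r by (intro continuous_intros isCont_powser[OF smm]) auto
  then have lim: "(P \<longlongrightarrow> P 1) (at_left 1)" "(P \<longlongrightarrow> P 1) (at_right 1)"
    by (auto simp: isCont_def intro: filterlim_at_split[THEN iffD1, THEN conjunct1]
        filterlim_at_split[THEN iffD1, THEN conjunct2])
  have P1: "P 1 = (\<Sum>i. a i)" by (simp add: P_def)
  consider "P 1 < 1" | "P 1 = 1" | "1 < P 1" by linarith
  then have "?L = 0 \<longleftrightarrow> P 1 = 1"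
  proof cases
    case 1
    have "eventually (\<lambda>x. P x < 1 \<and> x \<in> {1<..<r}) (at_right 1)"
      using order_tendstoD(2)[OF lim(2) 1] eventually_at_right_real[OF r]
      by (rule eventually_conj)
    then obtain x where x: "P x < 1" "1 < x" "x < r"
      using eventually_happens[of _ "at_right (1::real)"] by auto
    then have "?L \<le> ereal (- ln x)" by (intro le) auto
    also have "\<dots> < 0" using x by simp
    finally show ?thesis using 1 by auto
  next
    case 2
    then show ?thesis using le[of 1] ge[of 1] r by (auto intro!: antisym simp: zero_ereal_def)
  next
    case 3
    have "eventually (\<lambda>x. 1 < P x \<and> x \<in> {0<..<1}) (at_left 1)"
      using order_tendstoD(1)[OF lim(1) 3] eventually_at_left_real[of 0 "1::real"]
      by (intro eventually_conj) auto
    then obtain x where x: "1 < P x" "0 < x" "x < 1"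
      using eventually_happens[of _ "at_left (1::real)"] by auto
    have "0 < ereal (- ln x)" using x by simp
    also have "\<dots> \<le> ?L" using x r by (intro ge) auto
    finally show ?thesis using 3 by auto
  qed
  then show ?thesis by (simp add: P1)
qed

section \<open>Block words and their renewal recursion\<close>

text \<open>The empty product of blocks, which \<^const>\<open>block_words\<close> excludes, supplies the initial value
  \<open>u\<^sub>0 = 1\<close> of the renewal sequence.\<close>

definition block_products :: "nat set \<Rightarrow> nat \<Rightarrow> nat list set" where
  "block_products S n = {w. length w = n \<and>
     (\<exists>ss. set ss \<subseteq> S \<and> w = concat (map (\<lambda>s. replicate s 0 @ [1]) ss))}"

lemma block_products_0: "block_products S 0 = {[]}"
proof -
  have "[] \<in> block_products S 0"
    unfolding block_products_def by (auto intro!: exI[of _ "[]"])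
  then show ?thesis by (auto simp: block_products_def)
qed

lemma block_products_eq_block_words:
  assumes "0 < n"
  shows "block_products S n = block_words S n"
  unfolding block_products_def block_words_def using assms by fastforce

lemma finite_block_products: "finite (block_products S n)"
  by (cases "n = 0") (simp_all add: block_products_0 block_products_eq_block_words finite_block_words)

lemma block_products_Suc:
  "block_products S (Suc n) =
    (\<Union>s\<in>S \<inter> {..n}. (\<lambda>w. replicate s 0 @ 1 # w) ` block_products S (n - s))"
proof (intro set_eqI iffI)
  fix w assume "w \<in> block_products S (Suc n)"
  then obtain ss where len: "length w = Suc n" and ss: "set ss \<subseteq> S"
    and w: "w = concat (map (\<lambda>s. replicate s 0 @ [1]) ss)"
    by (auto simp: block_products_def)
  obtain s ts where sts: "ss = s # ts" using len w by (cases ss) auto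
  let ?v = "concat (map (\<lambda>s. replicate s 0 @ [1]) ts) :: nat list"
  have wv: "w = replicate s 0 @ 1 # ?v" using w sts by simp
  have lv: "s \<le> n" "length ?v = n - s" using len unfolding wv by auto
  have "?v \<in> block_products S (n - s)"
    using lv ss sts unfolding block_products_def by auto
  then show "w \<in> (\<Union>s\<in>S \<inter> {..n}. (\<lambda>w. replicate s 0 @ 1 # w) ` block_products S (n - s))"
    using wv lv ss sts by auto
next
  fix w assume "w \<in> (\<Union>s\<in>S \<inter> {..n}. (\<lambda>w. replicate s 0 @ 1 # w) ` block_products S (n - s))"
  then obtain s v where s: "s \<in> S" "s \<le> n" and v: "v \<in> block_products S (n - s)"
    and w: "w = replicate s 0 @ 1 # v" by auto
  obtain ts where ts: "set ts \<subseteq> S" "v = concat (map (\<lambda>s. replicate s 0 @ [1]) ts)"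
    and lv: "length v = n - s"
    using v by (auto simp: block_products_def)
  have "w = concat (map (\<lambda>s. replicate s 0 @ [1]) (s # ts))" using w ts by simp
  moreover have "length w = Suc n" using w lv s by simp
  moreover have "set (s # ts) \<subseteq> S" using s ts by simp
  ultimately show "w \<in> block_products S (Suc n)" unfolding block_products_def by blast
qed

text \<open>The renewal recursion. The first block of a word can be read off from its leading zeros, so the
  decomposition by first blocks is disjoint.\<close>

lemma block_sum_Suc:
  fixes g :: "nat list \<Rightarrow> real"
  assumes g: "\<And>v w. g (v @ w) = g v * g w"
  shows "sum g (block_products S (Suc n)) =
    (\<Sum>s\<le>n. (if s \<in> S then g (replicate s 0 @ [1]) else 0) * sum g (block_products S (n - s)))"
proof -
  let ?B = "\<lambda>s. (\<lambda>w. replicate s 0 @ 1 # w) ` block_products S (n - s)"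
  have zeros: "length (takeWhile (\<lambda>x. x = 0) (replicate s 0 @ (1::nat) # w)) = s" for s w
    by (subst takeWhile_append2) auto
  have disj: "?B s \<inter> ?B t = {}" if "s \<noteq> t" for s t
  proof (rule ccontr)
    assume "?B s \<inter> ?B t \<noteq> {}"
    then obtain v w where "replicate s 0 @ (1::nat) # v = replicate t 0 @ 1 # w" by auto
    then have "s = t" using zeros[of s v] zeros[of t w] by simp
    with that show False by simp
  qed
  have "sum g (block_products S (Suc n)) = (\<Sum>s\<in>S \<inter> {..n}. sum g (?B s))"
    unfolding block_products_Suc
    by (rule sum.UNION_disjoint) (use disj in \<open>auto simp: finite_block_products\<close>)
  also have "\<dots> = (\<Sum>s\<in>S \<inter> {..n}. g (replicate s 0 @ [1]) * sum g (block_products S (n - s)))"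
  proof (rule sum.cong[OF refl])
    fix s
    have "sum g (?B s) = (\<Sum>w\<in>block_products S (n - s). g ((replicate s 0 @ [1]) @ w))"
      by (subst sum.reindex) (auto simp: inj_on_def)
    then show "sum g (?B s) = g (replicate s 0 @ [1]) * sum g (block_products S (n - s))"
      by (simp only: g sum_distrib_left)
  qed
  also have "\<dots> = (\<Sum>s\<le>n. (if s \<in> S then g (replicate s 0 @ [1]) else 0)
      * sum g (block_products S (n - s)))"
    by (rule sum.mono_neutral_cong_left) auto
  finally show ?thesis .
qed

theorem proposition3p10:
  fixes S :: "nat set" and c :: "nat \<Rightarrow> real" and H :: real
  assumes "S \<noteq> {}"
    and "0 < c 0" "c 0 < 1" "0 < c 1" "c 1 < 1"
    and "H > 0"
  shows "Qbar S c H = 0 \<longleftrightarrow>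
    ((\<lambda>s. c 0 powr (real s * H) * c 1 powr H) has_sum 1) S"
proof -
  define g where "g w = word_ratio c w powr H" for w
  define u where "u n = sum g (block_products S n)" for n
  define b where "b s = c 0 powr (real s * H) * c 1 powr H" for s
  define a where "a s = (if s \<in> S then b s else 0)" for s
  have g_mult: "g (v @ w) = g v * g w" for v w
    by (simp add: g_def word_ratio_def powr_mult)
  have "word_ratio c (replicate s 0 @ [1]) = c 0 ^ s * c 1" for s
    by (simp add: word_ratio_def)
  then have g_block: "g (replicate s 0 @ [1]) = b s" for s
    using assms by (simp add: g_def b_def powr_mult powr_powr flip: powr_realpow)
  have u0: "u 0 = 1" by (simp add: u_def block_products_0 g_def word_ratio_def)
  have rec: "u (Suc n) = (\<Sum>i\<le>n. a i * u (n - i))" for n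
    unfolding u_def a_def block_sum_Suc[of g, OF g_mult] g_block by simp
  have b: "0 \<le> b i" for i by (simp add: b_def)
  have a: "0 \<le> a i" for i by (simp add: a_def b)
  have Q: "Qbar S c H = limsup (\<lambda>n. ereal (1 / real n) * log_ext (u n))"
    unfolding Qbar_def
  proof (rule Limsup_eq, rule eventually_mono[OF eventually_gt_at_top[of 0]])
    fix n :: nat assume "0 < n"
    then show "ereal (1 / real n) * log_ext (\<Sum>w\<in>block_words S n. word_ratio c w powr H) =
        ereal (1 / real n) * log_ext (u n)"
      by (simp add: u_def g_def block_products_eq_block_words)
  qed
  define d where "d = c 0 powr H"
  have d: "0 < d" "d < 1"
    using assms powr_less_mono'[of "c 0" 0 H] by (auto simp: d_def)
  have b_eq: "b i = d ^ i * c 1 powr H" for i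
    using assms by (simp add: b_def d_def powr_powr mult.commute flip: powr_realpow)
  \<comment> \<open>The power series with coefficients \<open>d\<^sup>i\<close> has radius of convergence \<open>1 / d\<close>; any point strictly
    between 1 and \<open>1 / d\<close> would do.\<close>
  obtain r where r: "1 < r" "r < 1 / d" using dense[of 1 "1 / d"] d by auto
  have "summable (\<lambda>i. (d * r) ^ i * c 1 powr H)"
    using d r by (intro summable_mult2 summable_geometric) (auto simp: field_simps abs_mult)
  then have smm: "summable (\<lambda>i. a i * r ^ i)"
    by (rule summable_comparison_test[rotated])
      (use r d in \<open>auto simp: a_def b_eq power_mult_distrib abs_mult intro!: exI[of _ 0]\<close>)
  have sma: "summable a" using powser_inside[OF smm, of 1] r by simp
  have "(b has_sum 1) S \<longleftrightarrow> (a has_sum 1) UNIV"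
    by (rule has_sum_cong_neutral) (auto simp: a_def)
  also have "\<dots> \<longleftrightarrow> a sums 1"
    using a by (auto intro: has_sum_imp_sums sums_nonneg_imp_has_sum)
  also have "\<dots> \<longleftrightarrow> (\<Sum>i. a i) = 1" using sma by (simp add: sums_iff)
  also have "\<dots> \<longleftrightarrow> Qbar S c H = 0"
    unfolding Q by (rule renewal_growth_eq_0_iff[of u a r, OF u0 rec a r(1) smm, symmetric])
  finally show ?thesis unfolding b_def by (rule sym)
qed

end
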